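(* Let $A(n;k,\ell,m)$ denote the number of four-coloured partitions of $n$ with the ordering $1_{a} < 1_{b} < 1_{c} <1_{d} <2_{a} < 2_{b} <2_{c} < 2_{d} < \cdots$ and the difference conditions given by the matrix $D$ below, having $k$ parts coloured $a$, $\ell$ parts coloured $c$ and $m$ parts coloured $d$. Then $$\sum_{n,k,\ell,m \geq 0} A(n;k,\ell,m) q^n a^k c^{\ell} d^m = \frac{(-aq;q^2)_{\infty}(-dq;q^2)_{\infty}}{(q;q)_{\infty}(cq;q^2)_{\infty}}.$$
   Context: Here $(a;q)_n := \prod_{j=0}^{n-1}(1-aq^j)$ for $n \in \mathbb{N}\cup\{\infty\}$. Consider partitions $(\lambda_1,\lambda_2,\dots)$ into parts of four colours $a,b,c,d$, where $k_z$ denotes the part $k\in\mathbb{N}$ of colour $z\in\{a,b,c,d\}$, with the order $1_{a} < 1_{b} < 1_{c} <1_{d} <2_{a} < 2_{b} <2_{c} < 2_{d} < \cdots$. The minimal difference $\lambda_i-\lambda_{i+1}$ between consecutive parts $\lambda_i$ of colour $x$ and $\lambda_{i+1}$ of colour $y$ is the entry $(x,y)$ of the matrix $D$ with rows/columns indexed by $a,b,c,d$: row $a$: $(2,1,2,2)$; row $b$: $(1,0,1,1)$; row $c$: $(0,1,0,2)$; row $d$: $(0,1,0,2)$. *)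

theory Defs
  imports "HOL-Analysis.Analysis"
begin

datatype colour = Col_a | Col_b | Col_c | Col_d

fun colour_rank :: "colour \<Rightarrow> nat" where
  "colour_rank Col_a = 0"
| "colour_rank Col_b = 1"
| "colour_rank Col_c = 2"
| "colour_rank Col_d = 3"

text \<open>The coloured part \<open>k\<^sub>z\<close> is the pair \<open>(k, z)\<close>.\<close>

definition part_le :: "nat \<times> colour \<Rightarrow> nat \<times> colour \<Rightarrow> bool" where
  "part_le p p' \<longleftrightarrow>
     fst p < fst p' \<or> fst p = fst p' \<and> colour_rank (snd p) \<le> colour_rank (snd p')"

fun min_diff :: "colour \<Rightarrow> colour \<Rightarrow> nat" where
  "min_diff Col_a Col_a = 2"
| "min_diff Col_a Col_b = 1"
| "min_diff Col_a Col_c = 2"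
| "min_diff Col_a Col_d = 2"
| "min_diff Col_b Col_a = 1"
| "min_diff Col_b Col_b = 0"
| "min_diff Col_b Col_c = 1"
| "min_diff Col_b Col_d = 1"
| "min_diff Col_c Col_a = 0"
| "min_diff Col_c Col_b = 1"
| "min_diff Col_c Col_c = 0"
| "min_diff Col_c Col_d = 2"
| "min_diff Col_d Col_a = 0"
| "min_diff Col_d Col_b = 1"
| "min_diff Col_d Col_c = 0"
| "min_diff Col_d Col_d = 2"

text \<open>
  A partition lists its parts from the largest to the smallest, so \<^const>\<open>successively\<close>
  relates \<open>\<lambda>\<^sub>i\<close> (first argument) to \<open>\<lambda>\<^sub>i\<^sub>+\<^sub>1\<close> (second argument). The difference condition
  is written additively because subtraction on \<^typ>\<open>nat\<close> truncates.
\<close>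

definition coloured_partition :: "(nat \<times> colour) list \<Rightarrow> bool" where
  "coloured_partition ps \<longleftrightarrow>
     (\<forall>p\<in>set ps. fst p \<ge> 1) \<and>
     successively (\<lambda>p p'. part_le p' p \<and>
                          fst p \<ge> fst p' + min_diff (snd p) (snd p')) ps"

definition partitions_of :: "nat \<Rightarrow> nat \<Rightarrow> nat \<Rightarrow> nat \<Rightarrow> (nat \<times> colour) list set" where
  "partitions_of n k l m =
     {ps. coloured_partition ps \<and> sum_list (map fst ps) = n \<and>
          count_list (map snd ps) Col_a = k \<and>
          count_list (map snd ps) Col_c = l \<and>
          count_list (map snd ps) Col_d = m}"

definition A :: "nat \<Rightarrow> nat \<Rightarrow> nat \<Rightarrow> nat \<Rightarrow> nat" where
  "A n k l m = card (partitions_of n k l m)"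

text \<open>Hence \<^const>\<open>A\<close> is not affected by \<^const>\<open>card\<close> being \<open>0\<close> on infinite sets.\<close>

lemma finite_partitions_of: "finite (partitions_of n k l m)"
proof (rule finite_subset)
  let ?S = "{..n} \<times> set [Col_a, Col_b, Col_c, Col_d]"
  show "finite {ps. set ps \<subseteq> ?S \<and> length ps \<le> n}"
    by (rule finite_lists_length_le) simp
  have len: "length ps \<le> sum_list (map fst ps)" if "\<forall>p\<in>set ps. fst p \<ge> 1"
    for ps :: "(nat \<times> colour) list"
    using that by (induction ps) auto
  have le: "fst p \<le> sum_list (map fst ps)" if "p \<in> set ps" for p and ps :: "(nat \<times> colour) list"
    using that by (intro member_le_sum_list) auto
  have col: "z \<in> set [Col_a, Col_b, Col_c, Col_d]" for z
    by (cases z) auto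
  show "partitions_of n k l m \<subseteq> {ps. set ps \<subseteq> ?S \<and> length ps \<le> n}"
    using len le col unfolding partitions_of_def coloured_partition_def by fastforce
qed

text \<open>
  For formal power series the infinite product is the limit in the library's topology on
  \<^type>\<open>fps\<close>, which is coefficientwise stabilisation in the (outermost) indeterminate.
\<close>

definition qpoch_inf :: "'r::{comm_ring_1,t2_space} \<Rightarrow> 'r \<Rightarrow> 'r" where
  "qpoch_inf x q = (\<Prod>j. 1 - x * q ^ j)"

text \<open>
  Formal power series in \<open>q, a, c, d\<close> with rational coefficients are iterated univariate
  series: \<open>q\<close> is the indeterminate of the outermost \<^type>\<open>fps\<close>, followed by \<open>a\<close>, \<open>c\<close> and
  \<open>d\<close>, so the coefficient of \<open>q\<^sup>n a\<^sup>k c\<^sup>l d\<^sup>m\<close> in \<open>F\<close> is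
  \<open>fps_nth (fps_nth (fps_nth (fps_nth F n) k) l) m\<close>.
\<close>

type_synonym fps4 = "rat fps fps fps fps"

definition var_q :: fps4 where "var_q = fps_X"
definition var_a :: fps4 where "var_a = fps_const fps_X"
definition var_c :: fps4 where "var_c = fps_const (fps_const fps_X)"
definition var_d :: fps4 where "var_d = fps_const (fps_const (fps_const fps_X))"

definition gen_series :: "(nat \<Rightarrow> nat \<Rightarrow> nat \<Rightarrow> nat \<Rightarrow> nat) \<Rightarrow> fps4" where
  "gen_series f =
     Abs_fps (\<lambda>n. Abs_fps (\<lambda>k. Abs_fps (\<lambda>l. Abs_fps (\<lambda>m. of_nat (f n k l m)))))"

end

theory Submission
  imports Defs
begin

text \<open>
  Let \<open>G\<^sub>k\<close> be the generating function of the partitions with all parts at most \<open>k\<close>. Sorting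
  partitions by their largest part gives linear relations which, for \<open>u\<^sub>k\<^sub>+\<^sub>1 = (q; q)\<^sub>k G\<^sub>k\<close>, combine
  to a third-order recurrence in \<open>k\<close>. Its solution is explicit:
  \<open>\<Sum>\<^sub>k u\<^sub>k x\<^sup>k / (q; q)\<^sub>k = (-x; q)\<^sub>\<infinity> \<Sum>\<^sub>j b\<^sub>j x\<^bsup>2j\<^esup> / (q\<^sup>2; q\<^sup>2)\<^sub>j\<close> with
  \<open>b\<^sub>j = (-aq; q\<^sup>2)\<^sub>j (-dq; q\<^sup>2)\<^sub>j / (cq; q\<^sup>2)\<^sub>j\<close>; this is checked through the \<open>q\<close>-difference
  equation satisfied by the right-hand side. Modulo \<open>q\<^sup>k\<close>, the coefficient of \<open>x\<^sup>k\<close> does not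
  change if every \<open>b\<^sub>j\<close> is replaced by \<open>b\<^sub>\<infinity>\<close>, and
  \<open>(-x; q)\<^sub>\<infinity> / (x\<^sup>2; q\<^sup>2)\<^sub>\<infinity> = 1 / (x; q)\<^sub>\<infinity>\<close> then yields \<open>u\<^sub>k \<equiv> b\<^sub>\<infinity>\<close>. Hence
  \<open>(q; q)\<^sub>\<infinity> G\<^sub>\<infinity> = b\<^sub>\<infinity>\<close>.
\<close>

section \<open>Formal power series\<close>

unbundle no vec_syntax
unbundle fps_syntax

text \<open>Divisibility by \<open>fps_X ^ n\<close> serves as congruence modulo \<open>q^n\<close>;
  the limits below are handled as such congruences.\<close>

lemma fps_X_power_dvd_iff:
  fixes f :: "'r::comm_ring_1 fps"
  shows "fps_X ^ n dvd f \<longleftrightarrow> (\<forall>i<n. f $ i = 0)"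
proof
  assume "fps_X ^ n dvd f"
  then show "\<forall>i<n. f $ i = 0"
    by (auto simp: dvd_def fps_X_power_mult_nth)
next
  assume "\<forall>i<n. f $ i = 0"
  then have "f = fps_X ^ n * fps_shift n f"
    by (auto simp: fps_eq_iff fps_X_power_mult_nth)
  then show "fps_X ^ n dvd f" by (rule dvdI)
qed

lemma fps_eq_0_if_X_powers_dvd:
  fixes f :: "'r::comm_ring_1 fps"
  assumes "\<And>n. fps_X ^ n dvd f"
  shows "f = 0"
proof (rule fps_ext)
  fix n show "f $ n = 0 $ n"
    using assms[of "Suc n"] unfolding fps_X_power_dvd_iff by auto
qed

lemma dvd_mult_diff:
  fixes d :: "'r::comm_ring_1"
  assumes "d dvd x - y" "d dvd x' - y'"
  shows "d dvd x * x' - y * y'"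
proof -
  have "x * x' - y * y' = x * (x' - y') + (x - y) * y'"
    by (simp add: algebra_simps)
  with assms show ?thesis by auto
qed

section \<open>Finite and infinite q-Pochhammer symbols\<close>

definition qpoch :: "'r::comm_ring_1 \<Rightarrow> 'r \<Rightarrow> nat \<Rightarrow> 'r" where
  "qpoch x q n = (\<Prod>j<n. 1 - x * q ^ j)"

lemma qpoch_0 [simp]: "qpoch x q 0 = 1"
  by (simp add: qpoch_def)

lemma qpoch_Suc: "qpoch x q (Suc n) = qpoch x q n * (1 - x * q ^ n)"
  by (simp add: qpoch_def)

lemma qpoch_nth_0:
  fixes x :: "'r::comm_ring_1 fps"
  assumes "x $ 0 = 0"
  shows "qpoch x q n $ 0 = 1"
  by (induction n) (auto simp: qpoch_Suc assms)

text \<open>A factor with index \<open>j \<ge> N\<close> differs from 1 by a multiple of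
  \<open>x * fps_X ^ (e * j)\<close>, and \<open>x\<close> contributes one more power of
  \<open>fps_X\<close>.\<close>

lemma qpoch_cong:
  fixes x :: "'r::comm_ring_1 fps"
  assumes "fps_X dvd x" "N \<le> M"
  shows "fps_X ^ (e * N + 1) dvd qpoch x (fps_X ^ e) M - qpoch x (fps_X ^ e) N"
  using assms(2)
proof (induction M rule: dec_induct)
  case (step n)
  from assms(1) obtain y where y: "x = fps_X * y" ..
  have "qpoch x (fps_X ^ e) (Suc n) - qpoch x (fps_X ^ e) n =
      fps_X ^ (e * n + 1) * (- y * qpoch x (fps_X ^ e) n)"
    by (simp add: qpoch_Suc y algebra_simps power_mult)
  also have "fps_X ^ (e * N + 1) dvd \<dots>"
    using step.hyps by (intro dvd_mult2 le_imp_power_dvd) auto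
  finally have "fps_X ^ (e * N + 1) dvd
      (qpoch x (fps_X ^ e) (Suc n) - qpoch x (fps_X ^ e) n) +
      (qpoch x (fps_X ^ e) n - qpoch x (fps_X ^ e) N)"
    using step.IH by (rule dvd_add)
  then show ?case by simp
qed auto

lemma
  fixes x :: "'r::idom fps"
  assumes x: "fps_X dvd x" and e: "e \<ge> 1"
  shows qpoch_inf_cong: "fps_X ^ (e * N + 1) dvd qpoch_inf x (fps_X ^ e) - qpoch x (fps_X ^ e) N"
    and qpoch_inf_nth_0: "qpoch_inf x (fps_X ^ e) $ 0 = 1"
proof -
  \<comment> \<open>Since \<open>e \<ge> 1\<close>, coefficient \<open>n\<close> is constant from
    the \<open>n\<close>-th partial product on, so the diagonal collects the limits.\<close>
  define P where "P = Abs_fps (\<lambda>n. qpoch x (fps_X ^ e) n $ n)"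
  have x0: "x $ 0 = 0" using x by auto
  have stable: "qpoch x (fps_X ^ e) M $ i = qpoch x (fps_X ^ e) N $ i"
    if "N \<le> M" "i < e * N + 1" for M N i
    using qpoch_cong[OF x that(1), of e] that(2) unfolding fps_X_power_dvd_iff by auto
  have P_nth: "P $ i = qpoch x (fps_X ^ e) M $ i" if "i < e * M + 1" for i M
  proof (cases "i \<le> M")
    case True
    have "i < e * i + 1" using e by (cases e) auto
    from stable[OF True this] show ?thesis by (simp add: P_def)
  next
    case False
    then show ?thesis using stable[of M i i] that by (simp add: P_def)
  qed
  have P0: "P $ 0 = 1" using x0 by (simp add: P_def)
  have "(\<lambda>n. \<Prod>j\<le>n. 1 - x * (fps_X ^ e) ^ j) \<longlonglongrightarrow> P"
  proof (rule tendsto_fpsI)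
    fix i
    show "\<forall>\<^sub>F n in sequentially. (\<Prod>j\<le>n. 1 - x * (fps_X ^ e) ^ j) $ i = P $ i"
    proof (rule eventually_sequentiallyI[of i])
      fix n assume "i \<le> n"
      then have "i < e * Suc n + 1" using e by (cases e) auto
      from P_nth[OF this] show "(\<Prod>j\<le>n. 1 - x * (fps_X ^ e) ^ j) $ i = P $ i"
        by (simp add: qpoch_def lessThan_Suc_atMost)
    qed
  qed
  \<comment> \<open>\<open>raw_has_prod\<close> demands a nonzero limit.\<close>
  moreover have "P \<noteq> 0" using P0 by auto
  ultimately have "(\<lambda>j. 1 - x * (fps_X ^ e) ^ j) has_prod P"
    by (simp add: has_prod_def raw_has_prod_def)
  then have eq: "qpoch_inf x (fps_X ^ e) = P"
    unfolding qpoch_inf_def by (metis has_prod_unique)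
  show "qpoch_inf x (fps_X ^ e) $ 0 = 1" using eq P0 by simp
  show "fps_X ^ (e * N + 1) dvd qpoch_inf x (fps_X ^ e) - qpoch x (fps_X ^ e) N"
    unfolding eq fps_X_power_dvd_iff by (auto simp: P_nth)
qed

text \<open>The inverse when the constant term is 1, formed without an \<open>inverse\<close>
  operation on the coefficient ring.\<close>

definition unit_inv :: "'r::comm_ring_1 fps \<Rightarrow> 'r fps" where
  "unit_inv f = fps_right_inverse f 1"

lemma mult_unit_inv:
  fixes f :: "'r::comm_ring_1 fps"
  assumes "f $ 0 = 1"
  shows "f * unit_inv f = 1"
  unfolding unit_inv_def by (rule fps_right_inverse) (simp add: assms)

text \<open>Turns the quotient of the theorem into a product. The coefficient ring there is not a
  field, so \<open>inverse\<close> of the constant term 1 is controlled by an assumption.\<close>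

lemma fps_divide_eq_if_mult_eq:
  fixes f g h :: "'r::{comm_ring_1, inverse} fps"
  assumes "inverse (1::'r) = 1" "g $ 0 = 1" "h * g = f"
  shows "f / g = h"
proof -
  have "g * inverse g = 1"
    unfolding fps_inverse_def by (rule fps_right_inverse) (simp add: assms)
  moreover have "f / g = f * inverse g"
    by (rule fps_divide_unit) (simp add: assms)
  ultimately show ?thesis
    using assms(3) by (metis mult.assoc mult.right_neutral)
qed

section \<open>Generating functions of coloured partitions\<close>

text \<open>The indeterminate is \<open>q\<close>; the other variables enter as colour weights in
  the coefficient ring.\<close>

definition part_gf :: "(colour \<Rightarrow> 'r::comm_ring_1) \<Rightarrow> (nat \<times> colour) list set \<Rightarrow> 'r fps" where
  "part_gf w P = Abs_fps (\<lambda>n. \<Sum>ps | ps \<in> P \<and> coloured_partition ps \<and> sum_list (map fst ps) = n.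
     prod_list (map (w \<circ> snd) ps))"

lemma coloured_partition_Cons:
  "coloured_partition ((k, z) # ps) \<longleftrightarrow>
     k \<ge> 1 \<and> coloured_partition ps \<and>
     (ps = [] \<or> part_le (hd ps) (k, z) \<and> k \<ge> fst (hd ps) + min_diff z (snd (hd ps)))"
  by (cases ps) (auto simp: coloured_partition_def)

lemma coloured_partition_Nil [simp]: "coloured_partition []"
  by (simp add: coloured_partition_def)

lemma length_le_sum_list:
  "coloured_partition ps \<Longrightarrow> length ps \<le> sum_list (map fst ps)"
proof (induction ps)
  case (Cons p ps)
  then show ?case by (cases p) (auto simp: coloured_partition_Cons)
qed simp

lemma finite_coloured_partitions:
  "finite {ps. ps \<in> P \<and> coloured_partition ps \<and> sum_list (map fst ps) = n}"
proof (rule finite_subset)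
  have "count_list (map snd ps) z \<le> sum_list (map fst ps)" if "coloured_partition ps" for ps z
    using count_le_length[of "map snd ps" z] length_le_sum_list[OF that] by simp
  then show "{ps. ps \<in> P \<and> coloured_partition ps \<and> sum_list (map fst ps) = n} \<subseteq>
      (\<Union>k\<le>n. \<Union>l\<le>n. \<Union>m\<le>n. partitions_of n k l m)"
    by (auto simp: partitions_of_def)
  show "finite (\<Union>k\<le>n. \<Union>l\<le>n. \<Union>m\<le>n. partitions_of n k l m)"
    by (intro finite_UN_I finite_atMost finite_partitions_of)
qed

lemma part_gf_Un:
  assumes "P \<inter> Q = {}"
  shows "part_gf w (P \<union> Q) = part_gf w P + part_gf w Q"
proof (rule fps_ext)
  fix n
  let ?S = "\<lambda>P. {ps. ps \<in> P \<and> coloured_partition ps \<and> sum_list (map fst ps) = n}"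
  have "?S (P \<union> Q) = ?S P \<union> ?S Q" by auto
  moreover have "?S P \<inter> ?S Q = {}" using assms by auto
  ultimately show "part_gf w (P \<union> Q) $ n = (part_gf w P + part_gf w Q) $ n"
    by (simp add: part_gf_def sum.union_disjoint finite_coloured_partitions)
qed

lemma part_gf_empty [simp]: "part_gf w {} = 0"
  by (simp add: part_gf_def fps_eq_iff)

lemma part_gf_Nil [simp]: "part_gf w {[]} = 1"
proof (rule fps_ext)
  fix n
  have "{ps. ps \<in> {[]} \<and> coloured_partition ps \<and> sum_list (map fst ps) = n} =
      (if n = 0 then {[]} else {})"
    by auto
  then show "part_gf w {[]} $ n = 1 $ n"
    unfolding part_gf_def by simp
qed

section \<open>Sorting partitions by their largest part\<close>

definition tails :: "nat \<Rightarrow> colour \<Rightarrow> (nat \<times> colour) list set" where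
  "tails k z = {ps. coloured_partition ((k, z) # ps)}"

definition headed :: "nat \<Rightarrow> colour \<Rightarrow> (nat \<times> colour) list set" where
  "headed k z = Cons (k, z) ` tails k z"

definition below :: "nat \<Rightarrow> (nat \<times> colour) list set" where
  "below k = {ps. coloured_partition ps \<and> (ps = [] \<or> fst (hd ps) \<le> k)}"

lemma part_gf_headed:
  "part_gf w (headed k z) = fps_const (w z) * fps_X ^ k * part_gf w (tails k z)"
proof (rule fps_ext)
  fix n
  let ?S = "\<lambda>P n. {ps. ps \<in> P \<and> coloured_partition ps \<and> sum_list (map fst ps) = n}"
  have S: "?S (headed k z) n = (if n < k then {} else Cons (k, z) ` ?S (tails k z) (n - k))"
    by (auto simp: headed_def tails_def coloured_partition_Cons)
  show "part_gf w (headed k z) $ n = (fps_const (w z) * fps_X ^ k * part_gf w (tails k z)) $ n"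
    unfolding part_gf_def mult.assoc fps_mult_left_const_nth fps_X_power_mult_nth fps_nth_Abs_fps S
    by (auto simp: sum.reindex sum_distrib_left)
qed

lemma mem_tails:
  "[] \<in> tails k z \<longleftrightarrow> k \<ge> 1"
  "(j, y) # ps \<in> tails k z \<longleftrightarrow> k \<ge> 1 \<and> coloured_partition ((j, y) # ps) \<and>
     part_le (j, y) (k, z) \<and> j + min_diff z y \<le> k"
  by (auto simp: tails_def coloured_partition_Cons)

lemma mem_headed:
  "[] \<notin> headed k z"
  "(j, y) # ps \<in> headed k z \<longleftrightarrow> j = k \<and> y = z \<and> coloured_partition ((j, y) # ps)"
  by (auto simp: headed_def tails_def)

lemma mem_below:
  "[] \<in> below k"
  "(j, y) # ps \<in> below k \<longleftrightarrow> j \<le> k \<and> coloured_partition ((j, y) # ps)"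
  by (auto simp: below_def)

lemma coloured_list_set_eqI:
  assumes "[] \<in> P \<longleftrightarrow> [] \<in> Q"
    and "\<And>j y ps. (j, y) # ps \<in> P \<longleftrightarrow> (j, y) # ps \<in> Q"
  shows "P = Q"
proof (rule set_eqI)
  fix ps show "ps \<in> P \<longleftrightarrow> ps \<in> Q"
    using assms by (cases ps) auto
qed

lemmas mem_lists = mem_tails mem_headed mem_below part_le_def

lemma below_split:
  assumes "k \<ge> 1"
  shows "below k = below (k - 1) \<union> headed k Col_a \<union> headed k Col_b \<union> headed k Col_c \<union> headed k Col_d"
proof (rule coloured_list_set_eqI)
  fix j y ps
  show "(j, y) # ps \<in> below k \<longleftrightarrow>
      (j, y) # ps \<in> below (k - 1) \<union> headed k Col_a \<union> headed k Col_b \<union> headed k Col_c \<union> headed k Col_d"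
    using assms by (cases y) (auto simp: mem_lists)
qed (auto simp: mem_lists)

text \<open>Row \<open>a\<close> of the matrix asks for difference 2 except before \<open>b\<close>.
  For \<open>k = 1\<close> the index \<open>k - 2\<close> truncates to 0, and only \<open>[]\<close>
  remains.\<close>

lemma tails_a:
  assumes "k \<ge> 1"
  shows "tails k Col_a = below (k - 2) \<union> headed (k - 1) Col_b"
proof (rule coloured_list_set_eqI)
  fix j y ps
  show "(j, y) # ps \<in> tails k Col_a \<longleftrightarrow> (j, y) # ps \<in> below (k - 2) \<union> headed (k - 1) Col_b"
    using assms by (cases y) (auto simp: mem_lists coloured_partition_Cons)
qed (use assms in \<open>auto simp: mem_lists\<close>)

lemma tails_b:
  assumes "k \<ge> 1"
  shows "tails k Col_b = below (k - 1) \<union> headed k Col_b"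
proof (rule coloured_list_set_eqI)
  fix j y ps
  show "(j, y) # ps \<in> tails k Col_b \<longleftrightarrow> (j, y) # ps \<in> below (k - 1) \<union> headed k Col_b"
    using assms by (cases y) (auto simp: mem_lists)
qed (use assms in \<open>auto simp: mem_lists\<close>)

text \<open>After \<open>k_c\<close>, all parts of size at most \<open>k - 1\<close> may come except
  \<open>(k-1)_d\<close>, and of size \<open>k\<close> only \<open>k_a\<close> and
  \<open>k_c\<close>. The exception stands on the left to avoid a set difference.\<close>

lemma tails_c:
  assumes "k \<ge> 1"
  shows "tails k Col_c \<union> headed (k - 1) Col_d = below (k - 1) \<union> headed k Col_a \<union> headed k Col_c"
proof (rule coloured_list_set_eqI)
  fix j y ps
  show "(j, y) # ps \<in> tails k Col_c \<union> headed (k - 1) Col_d \<longleftrightarrow>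
      (j, y) # ps \<in> below (k - 1) \<union> headed k Col_a \<union> headed k Col_c"
    using assms by (cases y) (auto simp: mem_lists)
qed (use assms in \<open>auto simp: mem_lists\<close>)

lemma tails_d: "tails k Col_d = tails k Col_c"
proof (rule coloured_list_set_eqI)
  fix j y ps
  show "(j, y) # ps \<in> tails k Col_d \<longleftrightarrow> (j, y) # ps \<in> tails k Col_c"
    by (cases y) (auto simp: mem_lists)
qed (auto simp: mem_lists)

lemma headed_0 [simp]: "headed 0 z = {}"
  by (simp add: headed_def tails_def coloured_partition_Cons)

lemma below_0 [simp]: "below 0 = {[]}"
  by (rule coloured_list_set_eqI) (auto simp: mem_lists coloured_partition_Cons)

lemma disjoint_headed:
  "z \<noteq> z' \<or> k \<noteq> k' \<Longrightarrow> headed k z \<inter> headed k' z' = {}"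
  by (auto simp: headed_def)

lemma disjoint_below_headed: "j < k \<Longrightarrow> below j \<inter> headed k z = {}"
  by (auto simp: headed_def below_def)

lemma disjoint_tails_c_headed: "k \<le> Suc j \<Longrightarrow> tails k Col_c \<inter> headed j Col_d = {}"
  by (auto simp: headed_def mem_lists)

lemma part_gf_below_split:
  assumes "k \<ge> 1"
  shows "part_gf w (below k) = part_gf w (below (k - 1)) + part_gf w (headed k Col_a) + part_gf w (headed k Col_b) + part_gf w (headed k Col_c) + part_gf w (headed k Col_d)"
  unfolding below_split[OF assms] using assms
  by (simp add: part_gf_Un Int_Un_distrib2 disjoint_headed disjoint_below_headed)

lemma part_gf_headed_a:
  assumes "k \<ge> 1"
  shows "part_gf w (headed k Col_a) = fps_const (w Col_a) * fps_X ^ k * (part_gf w (below (k - 2)) + part_gf w (headed (k - 1) Col_b))"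
proof -
  have "below (k - 2) \<inter> headed (k - 1) Col_b = {}"
    by (cases "k \<ge> 2") (use assms in \<open>auto intro!: disjoint_below_headed simp: not_le\<close>)
  then show ?thesis
    by (simp add: part_gf_headed[of w k] tails_a[OF assms] part_gf_Un)
qed

text \<open>Since \<open>k_b\<close> may repeat, the relation is implicit; solving it brings in the
  factor \<open>1 - q^k\<close> that the scaling by \<open>(q; q)_k\<close> absorbs.\<close>

lemma part_gf_headed_b:
  assumes "k \<ge> 1"
  shows "part_gf w (headed k Col_b) = fps_const (w Col_b) * fps_X ^ k * (part_gf w (below (k - 1)) + part_gf w (headed k Col_b))"
proof -
  have "below (k - 1) \<inter> headed k Col_b = {}"
    using assms by (intro disjoint_below_headed) auto
  then show ?thesis
    by (subst part_gf_headed) (simp add: tails_b[OF assms] part_gf_Un)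
qed

lemma part_gf_tails_c:
  assumes "k \<ge> 1"
  shows "part_gf w (tails k Col_c) + part_gf w (headed (k - 1) Col_d) = part_gf w (below (k - 1)) + part_gf w (headed k Col_a) + part_gf w (headed k Col_c)"
proof -
  have "part_gf w (tails k Col_c \<union> headed (k - 1) Col_d) =
      part_gf w (below (k - 1) \<union> headed k Col_a \<union> headed k Col_c)"
    by (simp only: tails_c[OF assms])
  then show ?thesis
    using assms
    by (simp add: part_gf_Un Int_Un_distrib2 disjoint_headed disjoint_below_headed disjoint_tails_c_headed)
qed

text \<open>
  At \<open>n = 0\<close> the truncated index \<open>n - 1\<close> is harmless: its coefficient contains
  \<open>1 - q\<^sup>n = 0\<close>.
\<close>

definition gf_recurrence :: "'r::comm_ring_1 fps \<Rightarrow> 'r fps \<Rightarrow> 'r fps \<Rightarrow> (nat \<Rightarrow> 'r fps) \<Rightarrow> bool" where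
  "gf_recurrence a c d u \<longleftrightarrow> (\<forall>n. let t = fps_X ^ Suc n in
     (1 - c * t) * (u (n + 2) - u (n + 1) - a * t * (1 - t) * u n) +
     d * t * (1 - t) * (u (n + 1) - u n - a * fps_X ^ n * (1 - fps_X ^ n) * u (n - 1)) =
     (c + d) * t * (1 - t) * (u (n + 1) + a * t * u n))"

text \<open>The coefficient of \<open>u (n + 2)\<close> is \<open>1 - c * t\<close>, which has
  constant term 1 and cancels over a domain. Two initial values suffice although the order is three,
  as the term with \<open>u (n - 1)\<close> vanishes at \<open>n = 0\<close>.\<close>

lemma gf_recurrence_unique:
  fixes a c d :: "'r::idom fps"
  assumes u: "gf_recurrence a c d u" and v: "gf_recurrence a c d v"
    and init: "u 0 = v 0" "u 1 = v 1"
  shows "u n = v n"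
proof (induction n rule: less_induct)
  case (less n)
  show ?case
  proof (cases "n < 2")
    case True
    then show ?thesis using init by (auto simp: less_2_cases_iff)
  next
    case False
    then obtain m where n: "n = m + 2" by (metis add.commute le_Suc_ex not_less)
    have eq: "u m = v m" "u (m + 1) = v (m + 1)" "u (m - 1) = v (m - 1)"
      by (rule less.IH; simp add: n)+
    define t :: "'r fps" where "t = fps_X ^ Suc m"
    have "(1 - c * t) * (u (m + 2) - v (m + 1) - a * t * (1 - t) * v m) =
        (1 - c * t) * (v (m + 2) - v (m + 1) - a * t * (1 - t) * v m)"
      using u[unfolded gf_recurrence_def Let_def, rule_format, of m, folded t_def]
        v[unfolded gf_recurrence_def Let_def, rule_format, of m, folded t_def]
      unfolding eq by (metis add_right_imp_eq)
    then have "(1 - c * t) * (u (m + 2) - v (m + 2)) = 0"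
      by (simp add: algebra_simps)
    moreover have "1 - c * t \<noteq> 0"
    proof
      assume "1 - c * t = 0"
      then have "(1 - c * t) $ 0 = 0" by simp
      then show False by (simp add: t_def)
    qed
    ultimately show ?thesis by (simp add: n)
  qed
qed

text \<open>
  The index is shifted by one, so that \<open>scaled_gf w 0\<close> stands for largest part at most \<open>-1\<close>;
  its value \<open>1\<close> is what the parts \<open>1\<^sub>a\<close> require.
\<close>

definition scaled_gf :: "(colour \<Rightarrow> 'r::comm_ring_1) \<Rightarrow> nat \<Rightarrow> 'r fps" where
  "scaled_gf w k = (if k = 0 then 1 else qpoch fps_X fps_X (k - 1) * part_gf w (below (k - 1)))"

text \<open>After scaling, the series with heads \<open>k_a\<close> and \<open>k_b\<close> are
  explicit multiples of values of \<open>u\<close>. What remains is \<open>z\<close>, the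
  contribution of heads \<open>k_c\<close> and \<open>k_d\<close>: splitting by the largest part
  expresses it through \<open>u\<close>, and the relation for \<open>tails k Col_c\<close> links
  \<open>z k\<close> to \<open>z (k - 1)\<close>.\<close>

lemma gf_recurrence_scaled_gf:
  fixes w :: "colour \<Rightarrow> 'r::comm_ring_1"
  assumes w: "w Col_b = 1"
  shows "gf_recurrence (fps_const (w Col_a)) (fps_const (w Col_c)) (fps_const (w Col_d)) (scaled_gf w)"
proof -
  let ?E = "\<lambda>k z. part_gf w (headed k z)" and ?G = "\<lambda>k. part_gf w (below k)"
  define a c d where acd: "a = fps_const (w Col_a)" "c = fps_const (w Col_c)" "d = fps_const (w Col_d)"
  define p :: "nat \<Rightarrow> 'r fps" where "p = qpoch fps_X fps_X"
  define u where "u = scaled_gf w"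
  define z where "z = (\<lambda>k. p k * (?E k Col_c + ?E k Col_d))"
  have p_Suc: "p (Suc k) = p k * (1 - fps_X ^ Suc k)" for k
    by (simp add: p_def qpoch_Suc)
  have u_Suc: "u (Suc k) = p k * ?G k" for k
    by (simp add: u_def p_def scaled_gf_def)
  have u_0: "u 0 = 1" by (simp add: u_def scaled_gf_def)
  have b: "p k * ?E k Col_b = fps_X ^ k * u k" if k: "k \<ge> 1" for k
  proof -
    obtain j where j: "k = Suc j" using k by (cases k) auto
    have "?E k Col_b * (1 - fps_X ^ k) = fps_X ^ k * ?G j"
      using part_gf_headed_b[OF k, of w] by (simp add: w j algebra_simps)
    then have "p j * (?E k Col_b * (1 - fps_X ^ k)) = p j * (fps_X ^ k * ?G j)"
      by (simp only:)
    then show ?thesis unfolding j p_Suc u_Suc by (simp only: mult_ac)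
  qed
  have a: "p k * ?E k Col_a = a * fps_X ^ k * (1 - fps_X ^ k) * u (k - 1)" if k: "k \<ge> 1" for k
  proof (cases "k = 1")
    case True
    then show ?thesis using part_gf_headed_a[OF k, of w] by (simp add: p_def qpoch_Suc u_0 acd mult_ac)
  next
    case False
    then obtain j where j: "k = Suc (Suc j)" using k by (metis One_nat_def nat.exhaust not_one_le_zero)
    have "p k * ?E k Col_a = a * fps_X ^ k * (1 - fps_X ^ k) * (p (Suc j) * ?G j + p (Suc j) * ?E (Suc j) Col_b)"
      using part_gf_headed_a[OF k, of w] by (simp add: j p_Suc acd algebra_simps)
    also have "p (Suc j) * ?G j = (1 - fps_X ^ Suc j) * u (Suc j)"
      by (simp only: p_Suc u_Suc mult_ac)
    \<comment> \<open>Scaled by \<open>p (Suc j)\<close>, the \<open>b\<close>-headed series is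
      \<open>fps_X ^ Suc j * u (Suc j)\<close>, exactly what the first term lacks.\<close>
    also have "(1 - fps_X ^ Suc j) * u (Suc j) + p (Suc j) * ?E (Suc j) Col_b = u (Suc j)"
      by (simp add: b left_diff_distrib del: power_Suc)
    finally show ?thesis by (simp add: j)
  qed
  have z: "z k = u (Suc k) - u k - a * fps_X ^ k * (1 - fps_X ^ k) * u (k - 1)" for k
  proof (cases "k = 0")
    case True
    then show ?thesis by (simp add: z_def u_Suc u_0 p_def)
  next
    case False
    then obtain j where j: "k = Suc j" by (cases k) auto
    have "p k * ?G k = (1 - fps_X ^ k) * (p j * ?G j) + p k * ?E k Col_a + p k * ?E k Col_b + z k"
      using part_gf_below_split[of k w] by (simp add: z_def j p_Suc algebra_simps)
    then show ?thesis
      using a[of k] b[of k] by (simp add: j u_Suc algebra_simps)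
  qed
  have "(1 - c * fps_X ^ k) * z k + d * fps_X ^ k * (1 - fps_X ^ k) * z (k - 1) =
      (c + d) * fps_X ^ k * (1 - fps_X ^ k) * (u k + a * fps_X ^ k * u (k - 1))"
    if k: "k \<ge> 1" for k
  proof -
    obtain j where j: "k = Suc j" using k by (cases k) auto
    define H where "H = (\<lambda>k. part_gf w (tails k Col_c))"
    define t :: "'r fps" where "t = fps_X ^ k"
    have Ec: "?E k Col_c = c * t * H k" and Ed: "?E k Col_d = d * t * H k"
      by (simp_all add: part_gf_headed acd H_def tails_d t_def)
    have zk: "z k = (c + d) * t * (p k * H k)"
      by (simp add: z_def Ec Ed algebra_simps)
    \<comment> \<open>Heads of colours \<open>c\<close> and \<open>d\<close> have the same tails, so
      their series are in the ratio \<open>c : d\<close>; multiplying by \<open>d\<close> avoids a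
      division by \<open>c + d\<close>.\<close>
    have zj: "d * z j = (c + d) * (p j * ?E j Col_d)"
      by (simp add: z_def part_gf_headed acd H_def tails_d algebra_simps del: fps_const_add)
    have H: "H k + ?E j Col_d = ?G j + ?E k Col_a + c * t * H k"
      using part_gf_tails_c[OF k, of w] by (simp add: j Ec[unfolded j] H_def)
    have pk: "p k = p j * (1 - t)" by (simp add: j p_Suc t_def)
    have ak: "p k * ?E k Col_a = a * t * (1 - t) * u j"
      using a[OF k] by (simp add: j t_def)
    have uk: "u k = p j * ?G j" by (simp add: j u_Suc)
    have "(1 - c * t) * z k + t * (1 - t) * (d * z j) =
        (c + d) * t * (p k * ((1 - c * t) * H k + ?E j Col_d))"
      unfolding zk zj pk by (simp add: algebra_simps)
    also have "(1 - c * t) * H k + ?E j Col_d = ?G j + ?E k Col_a"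
      using H by (simp add: algebra_simps)
    also have "p k * (?G j + ?E k Col_a) = (1 - t) * (u k + a * t * u j)"
      unfolding distrib_left ak unfolding uk pk by (simp add: algebra_simps)
    finally have "(1 - c * t) * z k + d * t * (1 - t) * z j =
        (c + d) * t * (1 - t) * (u k + a * t * u j)"
      by (simp only: mult_ac)
    then show ?thesis by (simp only: t_def j diff_Suc_1)
  qed
  from this[of "Suc n" for n] show ?thesis
    unfolding gf_recurrence_def Let_def acd[symmetric] u_def[symmetric] z by simp
qed

section \<open>Solution of the recurrence\<close>

text \<open>
  For series in a second variable \<open>x\<close> over power series in \<open>q\<close>, this is
  the substitution of \<open>x q\<close> for \<open>x\<close>.
\<close>

definition q_dilate :: "'r::comm_ring_1 fps fps \<Rightarrow> 'r fps fps" where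
  "q_dilate f = Abs_fps (\<lambda>n. fps_X ^ n * f $ n)"

lemma q_dilate_nth [simp]: "q_dilate f $ n = fps_X ^ n * f $ n"
  by (simp add: q_dilate_def)

lemma q_dilate_mult: "q_dilate (f * g) = q_dilate f * q_dilate g"
proof (rule fps_ext)
  fix n
  have "fps_X ^ n * (f $ i * g $ (n - i)) = fps_X ^ i * f $ i * (fps_X ^ (n - i) * g $ (n - i))"
    if "i \<le> n" for i
  proof -
    have "fps_X ^ n = fps_X ^ i * (fps_X :: 'a fps) ^ (n - i)"
      using that by (simp flip: power_add)
    then show ?thesis by (simp only: mult_ac)
  qed
  then show "q_dilate (f * g) $ n = (q_dilate f * q_dilate g) $ n"
    by (simp add: fps_mult_nth sum_distrib_left)
qed

lemma q_dilate_1_plus_X: "q_dilate (1 + fps_X) = 1 + fps_const fps_X * fps_X"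
proof (rule fps_ext)
  fix n
  show "q_dilate (1 + fps_X) $ n = (1 + fps_const fps_X * fps_X) $ n"
    by (cases "n = 0"; cases "n = 1") simp_all
qed

text \<open>
  By Euler, \<open>exp_series\<close> is \<open>(-x; q)\<^sub>\<infinity>\<close>; only the functional equation
  \<open>exp_series_eq\<close> is needed.
\<close>

definition exp_series :: "'r::comm_ring_1 fps fps" where
  "exp_series = Abs_fps (\<lambda>m. fps_X ^ (m choose 2) * unit_inv (qpoch fps_X fps_X m))"

text \<open>For constant \<open>b = 1\<close> this is \<open>1 / (x^2; q^2)_\<infinity>\<close> by
  Euler.\<close>

definition even_series :: "(nat \<Rightarrow> 'r::comm_ring_1 fps) \<Rightarrow> 'r fps fps" where
  "even_series b = Abs_fps (\<lambda>k. if even k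
     then b (k div 2) * unit_inv (qpoch (fps_X\<^sup>2) (fps_X\<^sup>2) (k div 2)) else 0)"

lemma exp_series_0 [simp]: "exp_series $ 0 = 1"
  using mult_unit_inv[of "1 :: 'a fps"] by (simp add: exp_series_def numeral_2_eq_2)

lemma even_series_0 [simp]: "even_series b $ 0 = b 0"
  using mult_unit_inv[of "1 :: 'a fps"] by (simp add: even_series_def)

lemma unit_inv_mult:
  fixes f g :: "'r::comm_ring_1 fps"
  assumes "f $ 0 = 1" "g $ 0 = 1"
  shows "unit_inv (f * g) * g = unit_inv f"
proof -
  have f: "f * unit_inv f = 1" and fg: "f * g * unit_inv (f * g) = 1"
    using assms by (auto intro!: mult_unit_inv)
  have "unit_inv (f * g) * g = unit_inv (f * g) * g * (f * unit_inv f)"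
    by (simp add: f)
  also have "\<dots> = (f * g * unit_inv (f * g)) * unit_inv f"
    by (simp only: mult_ac)
  finally show ?thesis by (simp add: fg)
qed

lemma exp_series_Suc:
  "(1 - fps_X ^ Suc m) * exp_series $ Suc m = fps_X ^ m * (exp_series $ m :: 'r::comm_ring_1 fps)"
proof -
  have "unit_inv (qpoch fps_X fps_X (Suc m)) * (1 - fps_X ^ Suc m) =
      unit_inv (qpoch fps_X fps_X m :: 'r fps)"
    unfolding qpoch_Suc power_Suc[symmetric]
    by (rule unit_inv_mult) (simp_all add: qpoch_nth_0)
  moreover have "Suc m choose 2 = m + (m choose 2)"
    by (simp add: numeral_2_eq_2)
  moreover have "(1 - fps_X ^ Suc m) * exp_series $ Suc m =
      fps_X ^ (Suc m choose 2) * (unit_inv (qpoch fps_X fps_X (Suc m)) * (1 - fps_X ^ Suc m) :: 'r fps)"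
    by (simp only: exp_series_def fps_nth_Abs_fps mult_ac)
  ultimately show ?thesis
    by (simp add: exp_series_def power_add mult.assoc del: power_Suc)
qed

text \<open>Splits the first factor off \<open>(-x; q)_\<infinity>\<close>; on coefficients this is
  \<open>exp_series_Suc\<close>.\<close>

lemma exp_series_eq: "exp_series = (1 + fps_X) * q_dilate exp_series"
proof (rule fps_ext)
  fix n show "exp_series $ n = ((1 + fps_X) * q_dilate exp_series) $ n"
  proof (cases n)
    case (Suc m)
    then show ?thesis
      using exp_series_Suc[of m] by (simp add: algebra_simps)
  qed (simp add: distrib_right)
qed

lemma even_series_Suc:
  fixes b :: "nat \<Rightarrow> 'r::comm_ring_1 fps"
  assumes "x * b (Suc j) = y * b j"
  shows "x * (1 - fps_X ^ (2 * Suc j)) * even_series b $ (2 * Suc j) = y * even_series b $ (2 * j)"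
proof -
  have "unit_inv (qpoch (fps_X\<^sup>2) (fps_X\<^sup>2) (Suc j)) * (1 - fps_X\<^sup>2 * (fps_X\<^sup>2) ^ j) =
      unit_inv (qpoch (fps_X\<^sup>2) (fps_X\<^sup>2) j :: 'r fps)"
    unfolding qpoch_Suc by (rule unit_inv_mult) (simp_all add: qpoch_nth_0)
  moreover have "fps_X\<^sup>2 * (fps_X\<^sup>2) ^ j = (fps_X :: 'r fps) ^ (2 * Suc j)"
    by (simp only: power_mult power_Suc)
  ultimately have D: "unit_inv (qpoch (fps_X\<^sup>2) (fps_X\<^sup>2) (Suc j)) * (1 - fps_X ^ (2 * Suc j)) =
      unit_inv (qpoch (fps_X\<^sup>2) (fps_X\<^sup>2) j :: 'r fps)" by simp
  have "x * (1 - fps_X ^ (2 * Suc j)) * even_series b $ (2 * Suc j) =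
      (x * b (Suc j)) * (unit_inv (qpoch (fps_X\<^sup>2) (fps_X\<^sup>2) (Suc j)) * (1 - fps_X ^ (2 * Suc j)))"
    by (simp add: even_series_def mult_ac)
  also have "\<dots> = y * even_series b $ (2 * j)"
    unfolding assms D by (simp add: even_series_def mult_ac)
  finally show ?thesis .
qed

lemma even_series_odd [simp]: "odd n \<Longrightarrow> even_series b $ n = 0"
  by (simp add: even_series_def)

lemma even_series_1_eq:
  fixes D :: "'r::comm_ring_1 fps fps"
  defines "D \<equiv> even_series (\<lambda>_. 1)"
  shows "(1 - fps_X\<^sup>2) * D = q_dilate D"
proof (rule fps_ext)
  fix n show "((1 - fps_X\<^sup>2) * D) $ n = q_dilate D $ n"
  proof (cases "even n \<and> n > 0")
    case True
    then obtain j where j: "n = 2 * Suc j"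
      by (metis dvdE gr0_implies_Suc mult_0_right neq0_conv)
    have "(1 - fps_X ^ (2 * Suc j)) * D $ (2 * Suc j) = D $ (2 * j)"
      unfolding D_def using even_series_Suc[of 1 "\<lambda>_. 1" j 1] by simp
    then have "D $ n - D $ (2 * j) = fps_X ^ n * D $ n"
      by (simp only: j left_diff_distrib mult_1 diff_eq_eq eq_diff_eq add.commute)
    then show ?thesis
      by (simp add: j left_diff_distrib fps_X_power_mult_nth)
  next
    case False
    then show ?thesis
      by (auto simp: left_diff_distrib fps_X_power_mult_nth D_def)
  qed
qed

text \<open>This is \<open>(-x; q)\<^sub>\<infinity> / (x\<^sup>2; q\<^sup>2)\<^sub>\<infinity> = 1 / (x; q)\<^sub>\<infinity>\<close> read off at \<open>x\<^sup>n\<close>.\<close>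

lemma exp_mult_even_1:
  "qpoch fps_X fps_X n * (exp_series * even_series (\<lambda>_. 1)) $ n = (1 :: 'r::idom fps)"
proof -
  define D :: "'r fps fps" where "D = even_series (\<lambda>_. 1)"
  define V where "V = exp_series * D"
  \<comment> \<open>The extra factor \<open>1 + fps_X\<close> completes \<open>1 - fps_X\<close> to
    what \<open>even_series_1_eq\<close> expects; it reappears from \<open>exp_series_eq\<close> and
    can then be cancelled.\<close>
  have "(1 + fps_X) * ((1 - fps_X) * V) = (1 - fps_X\<^sup>2) * V"
    by (simp add: algebra_simps power2_eq_square)
  also have "\<dots> = exp_series * ((1 - fps_X\<^sup>2) * D)"
    by (simp add: V_def mult_ac)
  also have "\<dots> = exp_series * q_dilate D"
    unfolding D_def even_series_1_eq ..
  also have "\<dots> = (1 + fps_X) * q_dilate V"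
    unfolding V_def q_dilate_mult by (subst exp_series_eq) (simp only: mult_ac)
  finally have "(1 + fps_X) * ((1 - fps_X) * V) = (1 + fps_X) * q_dilate V" .
  moreover have "(1 + fps_X :: 'r fps fps) \<noteq> 0"
  proof
    assume "1 + fps_X = (0 :: 'r fps fps)"
    then have "(1 + fps_X) $ 0 = (0 :: 'r fps fps) $ 0" by (rule arg_cong)
    then show False by simp
  qed
  ultimately have V: "(1 - fps_X) * V = q_dilate V" by simp
  have "qpoch fps_X fps_X n * V $ n = 1"
  proof (induction n)
    case 0
    then show ?case by (simp add: V_def D_def)
  next
    case (Suc n)
    have "((1 - fps_X) * V) $ Suc n = q_dilate V $ Suc n" by (simp only: V)
    then have "(1 - fps_X * fps_X ^ n) * V $ Suc n = V $ n"
      by (simp add: algebra_simps)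
    then show ?case using Suc.IH by (simp add: qpoch_Suc mult.assoc)
  qed
  then show ?thesis by (simp add: V_def D_def)
qed

text \<open>The left-hand side is \<open>q\<close> times the difference of the two sides of the
  assumption. It is used with \<open>t = q^(2j)\<close> and with \<open>x\<close>, \<open>y\<close>
  the coefficients at \<open>2j + 2\<close> and \<open>2j\<close>.\<close>

lemma even_series_coeff_identity:
  fixes a c d q t x y :: "'r::comm_ring_1"
  assumes "(1 - c * q * t) * (1 - q\<^sup>2 * t) * x = (1 + a * q * t) * (1 + d * q * t) * y"
  shows "q * (x - y) - ((q + c) * (q\<^sup>2 * t * x) + (a + d) * q\<^sup>2 * (t * y)) +
    (c * (q\<^sup>2 * t * (q\<^sup>2 * t * x)) - a * d * q ^ 3 * (t * (t * y))) = 0"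
proof -
  have "q * (x - y) - ((q + c) * (q\<^sup>2 * t * x) + (a + d) * q\<^sup>2 * (t * y)) +
      (c * (q\<^sup>2 * t * (q\<^sup>2 * t * x)) - a * d * q ^ 3 * (t * (t * y))) =
    q * ((1 - c * q * t) * (1 - q\<^sup>2 * t) * x - (1 + a * q * t) * (1 + d * q * t) * y)"
    by (simp add: algebra_simps power2_eq_square power3_eq_cube)
  then show ?thesis using assms by simp
qed

text \<open>The relation between consecutive even coefficients is quadratic in
  \<open>q^(2j)\<close>. Each dilation multiplies the coefficient at \<open>2j\<close> by
  \<open>q^(2j)\<close>, so the relation becomes an equation between \<open>U\<close> and its first
  two dilates.\<close>

lemma even_series_eq:
  fixes a c d :: "'r::comm_ring_1 fps"
  assumes b: "\<And>j. (1 - c * fps_X * (fps_X\<^sup>2) ^ j) * b (Suc j) =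
      (1 + a * fps_X * (fps_X\<^sup>2) ^ j) * (1 + d * fps_X * (fps_X\<^sup>2) ^ j) * b j"
  defines "U \<equiv> even_series b"
  shows "fps_const fps_X * ((1 - fps_X\<^sup>2) * U) -
     (fps_const (fps_X + c) + fps_const ((a + d) * fps_X\<^sup>2) * fps_X\<^sup>2) * q_dilate U +
     (fps_const c - fps_const (a * d * fps_X ^ 3) * fps_X\<^sup>2) * q_dilate (q_dilate U) = 0"
    (is "?F = 0")
proof (rule fps_ext)
  fix n
  have F: "?F $ n = fps_X * (U $ n - (fps_X\<^sup>2 * U) $ n) -
     ((fps_X + c) * q_dilate U $ n + (a + d) * fps_X\<^sup>2 * (fps_X\<^sup>2 * q_dilate U) $ n) +
     (c * q_dilate (q_dilate U) $ n - a * d * fps_X ^ 3 * (fps_X\<^sup>2 * q_dilate (q_dilate U)) $ n)"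
    unfolding ring_distribs mult.assoc[of _ "fps_X\<^sup>2"]
    by (simp add: mult.assoc) (simp add: algebra_simps)
  show "?F $ n = 0 $ n"
  proof (cases "even n \<and> n > 0")
    case True
    then obtain j where j: "n = 2 * Suc j"
      by (metis dvdE gr0_implies_Suc mult_0_right neq0_conv)
    define t :: "'r fps" where "t = (fps_X\<^sup>2) ^ j"
    have t: "fps_X ^ (2 * j) = t" "fps_X ^ n = fps_X\<^sup>2 * t"
      by (simp_all only: t_def j power_mult power_Suc)
    have "(1 - c * fps_X * t) * (1 - fps_X\<^sup>2 * t) * U $ n =
        (1 + a * fps_X * t) * (1 + d * fps_X * t) * U $ (2 * j)"
      using even_series_Suc[OF b[of j]] by (simp only: U_def t_def[symmetric] t[unfolded j] j)
    from even_series_coeff_identity[OF this] show ?thesis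
      unfolding F q_dilate_nth fps_X_power_mult_nth using t by (simp add: j)
  next
    case False
    \<comment> \<open>Odd coefficients vanish, and at \<open>n = 0\<close> the factors add up to
      \<open>q - (q + c) + c = 0\<close>.\<close>
    then show ?thesis
      unfolding F by (auto simp: fps_X_power_mult_nth U_def distrib_right)
  qed
qed

text \<open>Applying \<open>exp_series_eq\<close> twice writes \<open>V\<close> and its dilates as
  multiples of \<open>E\<close>, the second dilate of \<open>exp_series\<close>. The claim is then
  \<open>(1 + q x) * E\<close> times the equation for \<open>even_series b\<close>, because
  \<open>(1 - x) * (1 + x) = 1 - x^2\<close>.\<close>

lemma exp_mult_even_eq:
  fixes a c d :: "'r::comm_ring_1 fps"
  assumes b: "\<And>j. (1 - c * fps_X * (fps_X\<^sup>2) ^ j) * b (Suc j) =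
      (1 + a * fps_X * (fps_X\<^sup>2) ^ j) * (1 + d * fps_X * (fps_X\<^sup>2) ^ j) * b j"
  defines "V \<equiv> exp_series * even_series b"
  shows "fps_const fps_X * ((1 - fps_X) * V) -
     (fps_const (fps_X + c) + fps_const ((a + d) * fps_X\<^sup>2) * fps_X\<^sup>2) * q_dilate V +
     (1 + fps_const fps_X * fps_X) *
     (fps_const c - fps_const (a * d * fps_X ^ 3) * fps_X\<^sup>2) * q_dilate (q_dilate V) = 0"
proof -
  define U where "U = even_series b"
  define E :: "'r fps fps" where "E = q_dilate (q_dilate exp_series)"
  have TE: "q_dilate exp_series = (1 + fps_const fps_X * fps_X) * E"
    unfolding E_def q_dilate_1_plus_X[symmetric] q_dilate_mult[symmetric]
    by (simp only: exp_series_eq[symmetric])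
  have "exp_series = (1 + fps_X) * ((1 + fps_const fps_X * fps_X) * E)"
    unfolding TE[symmetric] by (rule exp_series_eq)
  then have V: "V = (1 + fps_X) * (1 + fps_const fps_X * fps_X) * E * U"
    unfolding V_def U_def by (simp only: mult.assoc)
  have TV: "q_dilate V = (1 + fps_const fps_X * fps_X) * E * q_dilate U"
    by (simp add: V_def U_def q_dilate_mult TE)
  have TTV: "q_dilate (q_dilate V) = E * q_dilate (q_dilate U)"
    by (simp add: V_def U_def q_dilate_mult E_def)
  note eq = even_series_eq[of c b a d, OF b, folded U_def]
  have alg: "q * ((1 - x) * ((1 + x) * y * E * U)) - s * (y * E * U') + y * r * (E * U'') =
      y * E * (q * ((1 - x\<^sup>2) * U) - s * U' + r * U'')"
    for q x y s r U' U'' :: "'r fps fps"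
    by (simp add: algebra_simps power2_eq_square)
  show ?thesis
    unfolding TTV unfolding TV by (subst V) (simp only: alg eq mult_zero_right)
qed

text \<open>Coefficients at \<open>x^(n+2)\<close> are compared in the \<open>q\<close>-difference
  equation. The factor \<open>1 + q x\<close> raises its degree in \<open>x\<close> to three, which
  is where index \<open>n - 1\<close> comes from.\<close>

lemma gf_recurrence_exp_mult_even:
  fixes a c d :: "'r::idom fps"
  assumes b: "\<And>j. (1 - c * fps_X * (fps_X\<^sup>2) ^ j) * b (Suc j) =
      (1 + a * fps_X * (fps_X\<^sup>2) ^ j) * (1 + d * fps_X * (fps_X\<^sup>2) ^ j) * b j"
  defines "V \<equiv> exp_series * even_series b"
  shows "gf_recurrence a c d (\<lambda>k. qpoch fps_X fps_X k * V $ k)"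
proof -
  have "let t = fps_X ^ Suc n; u = \<lambda>k. qpoch fps_X fps_X k * V $ k in
     (1 - c * t) * (u (n + 2) - u (n + 1) - a * t * (1 - t) * u n) +
     d * t * (1 - t) * (u (n + 1) - u n - a * fps_X ^ n * (1 - fps_X ^ n) * u (n - 1)) =
     (c + d) * t * (1 - t) * (u (n + 1) + a * t * u n)" for n
  proof -
    define q :: "'r fps" where "q = fps_X"
    define t where "t = q ^ n"
    define p where "p = qpoch q q n"
    define z where "z = (if n = 0 then 0 else V $ (n - 1))"
    define x y v where "x = V $ (n + 2)" and "y = V $ (n + 1)" and "v = V $ n"
    let ?X = "fps_X :: 'r fps fps"
    have expand: "k * ((1 - x) * V) - (s + r * x\<^sup>2) * T + (1 + k * x) * (m - l * x\<^sup>2) * T' =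
        k * V - k * (x * V) - (s * T + r * (x\<^sup>2 * T)) +
        (m * T' + m * k * (x * T') - l * (x\<^sup>2 * T') - l * k * (x ^ 3 * T'))"
      for k x s r T m l T' :: "'r fps fps"
      by (simp add: algebra_simps power2_eq_square power3_eq_cube)
    have "(fps_const q * V - fps_const q * (?X * V) -
        (fps_const (q + c) * q_dilate V + fps_const ((a + d) * q\<^sup>2) * (?X\<^sup>2 * q_dilate V)) +
        (fps_const c * q_dilate (q_dilate V) + fps_const c * fps_const q * (?X * q_dilate (q_dilate V)) -
         fps_const (a * d * q ^ 3) * (?X\<^sup>2 * q_dilate (q_dilate V)) -
         fps_const (a * d * q ^ 3) * fps_const q * (?X ^ 3 * q_dilate (q_dilate V)))) $ (n + 2) = 0"
      unfolding expand[symmetric] unfolding q_def V_def exp_mult_even_eq[OF b] by simp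
    then have main: "q * x - q * y - ((q + c) * (q ^ (n + 2) * x) + (a + d) * q\<^sup>2 * (t * v)) +
        (c * (q ^ (n + 2) * (q ^ (n + 2) * x)) + c * q * (q ^ (n + 1) * (q ^ (n + 1) * y)) -
         a * d * q ^ 3 * (t * (t * v)) -
         a * d * q ^ 3 * q * (if n = 0 then 0 else q ^ (n - 1) * (q ^ (n - 1) * z))) = 0"
      by (simp add: fps_X_power_mult_nth x_def y_def v_def z_def t_def q_def[symmetric] mult.assoc
          del: power_Suc cong: if_cong)
    have z': "a * d * q ^ 3 * q * (if n = 0 then 0 else q ^ (n - 1) * (q ^ (n - 1) * z)) =
        a * d * q\<^sup>2 * (t * t * z)"
      by (cases n) (simp_all add: t_def z_def power2_eq_square power3_eq_cube mult_ac)
    have pow: "q ^ (n + 2) = q * (q * t)" "q ^ (n + 1) = q * t"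
      by (simp_all add: t_def)
    have "q * x - q * y - ((q + c) * (q * (q * t) * x) + (a + d) * q\<^sup>2 * (t * v)) +
        (c * (q * (q * t) * (q * (q * t) * x)) + c * q * (q * t * (q * t * y)) -
         a * d * q ^ 3 * (t * (t * v)) - a * d * q\<^sup>2 * (t * t * z)) = 0"
      using main unfolding z' pow .
    \<comment> \<open>Up to the factor \<open>q\<close>, this is the recurrence before scaling by
      \<open>(q; q)_k\<close>.\<close>
    then have "q * ((1 - c * (q * t)) * ((1 - q * (q * t)) * x - y - a * (q * t) * v) +
       d * (q * t) * ((1 - q * t) * y - v - a * t * z) -
       (c + d) * (q * t) * ((1 - q * t) * y + a * (q * t) * v)) = 0"
      by (simp add: algebra_simps power2_eq_square power3_eq_cube)
    then have eq: "(1 - c * (q * t)) * ((1 - q * (q * t)) * x - y - a * (q * t) * v) +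
       d * (q * t) * ((1 - q * t) * y - v - a * t * z) =
       (c + d) * (q * t) * ((1 - q * t) * y + a * (q * t) * v)"
      by (simp add: q_def)
    \<comment> \<open>At \<open>n = 0\<close> both sides are 0: on the left through
      \<open>1 - t = 0\<close>, on the right by the convention for \<open>z\<close>.\<close>
    have z: "a * t * (1 - t) * (qpoch q q (n - 1) * V $ (n - 1)) = a * t * (p * z)"
      by (cases n) (simp_all add: t_def z_def p_def qpoch_Suc mult_ac)
    have p1: "qpoch q q (n + 1) = p * (1 - q * t)"
      by (simp add: p_def qpoch_Suc t_def)
    have p2: "qpoch q q (n + 2) = p * (1 - q * t) * (1 - q * (q * t))"
      by (simp add: p_def qpoch_Suc t_def)
    have factor: "(1 - c * s) * (p * (1 - s) * (1 - q * s) * x - p * (1 - s) * y - a * s * (1 - s) * (p * v)) +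
       d * s * (1 - s) * (p * (1 - s) * y - p * v - a * t * (p * z)) =
       p * (1 - s) * ((1 - c * s) * ((1 - q * s) * x - y - a * s * v) +
       d * s * ((1 - s) * y - v - a * t * z))"
      "(c + d) * s * (1 - s) * (p * (1 - s) * y + a * s * (p * v)) =
       p * (1 - s) * ((c + d) * s * ((1 - s) * y + a * s * v))" for s
      by (simp_all add: algebra_simps)
    show ?thesis
      unfolding Let_def q_def[symmetric] power_Suc t_def[symmetric] z p1 p2
        x_def[symmetric] y_def[symmetric] v_def[symmetric] p_def[symmetric] factor eq ..
  qed
  then show ?thesis unfolding gf_recurrence_def Let_def by blast
qed

section \<open>The limit\<close>

text \<open>
  The error terms have order at least \<open>(i choose 2) + 2 j + 1 \<ge> n\<close> where \<open>i + 2 j = n\<close>, so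
  letting \<open>n\<close> grow replaces \<open>b\<close> by its limit \<open>B\<close>.
\<close>

lemma exp_mult_even_cong:
  fixes b :: "nat \<Rightarrow> 'r::comm_ring_1 fps"
  assumes b: "\<And>j. fps_X ^ (2 * j + 1) dvd b j - B"
  shows "fps_X ^ n dvd (exp_series * even_series b) $ n - B * (exp_series * even_series (\<lambda>_. 1)) $ n"
proof -
  have "(exp_series * even_series b) $ n - B * (exp_series * even_series (\<lambda>_. 1)) $ n =
      (\<Sum>i=0..n. exp_series $ i * (even_series b $ (n - i) - B * even_series (\<lambda>_. 1) $ (n - i)))"
    by (simp add: fps_mult_nth sum_distrib_left right_diff_distrib sum_subtractf mult.left_commute)
  also have "fps_X ^ n dvd \<dots>"
  proof (rule dvd_sum)
    fix i assume "i \<in> {0..n}"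
    show "fps_X ^ n dvd exp_series $ i * (even_series b $ (n - i) - B * even_series (\<lambda>_. 1) $ (n - i))"
    proof (cases "even (n - i)")
      case True
      then obtain j where j: "n - i = 2 * j" ..
      have eq: "even_series b $ (n - i) - B * even_series (\<lambda>_. 1) $ (n - i) =
          (b j - B) * unit_inv (qpoch (fps_X\<^sup>2) (fps_X\<^sup>2) j)"
        by (simp add: even_series_def j left_diff_distrib)
      have "fps_X ^ (i choose 2) dvd exp_series $ i"
        by (simp add: exp_series_def)
      then have "fps_X ^ (i choose 2) * fps_X ^ (2 * j + 1) dvd
          exp_series $ i * (even_series b $ (n - i) - B * even_series (\<lambda>_. 1) $ (n - i))"
        unfolding eq by (rule mult_dvd_mono) (rule dvd_mult2[OF b])
      \<comment> \<open>Equality holds at \<open>i = 1\<close> and \<open>i = 2\<close>, so the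
        \<open>+ 1\<close> in the exponent of the assumption on \<open>b\<close> is used in
        full.\<close>
      moreover have "i \<le> (i choose 2) + 1"
      proof (induction i)
        case (Suc i)
        then show ?case by (cases i) (auto simp: numeral_2_eq_2)
      qed simp
      then have "n \<le> (i choose 2) + (2 * j + 1)"
        using j \<open>i \<in> {0..n}\<close> by auto
      then have "fps_X ^ n dvd (fps_X :: 'r fps) ^ ((i choose 2) + (2 * j + 1))"
        by (rule le_imp_power_dvd)
      ultimately show ?thesis
        unfolding power_add[symmetric] by (blast intro: dvd_trans)
    qed simp
  qed
  finally show ?thesis .
qed

text \<open>\<open>B\<close> is the limit of the quotients \<open>b j\<close>. Uniqueness identifies
  \<open>scaled_gf\<close> with the explicit solution, in which \<open>b\<close> may be replaced by
  \<open>B\<close> modulo \<open>q^n\<close>; by \<open>exp_mult_even_1\<close> the result is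
  \<open>B\<close> itself.\<close>

lemma scaled_gf_cong:
  fixes w :: "colour \<Rightarrow> 'r::idom"
  assumes w: "w Col_b = 1"
    and B: "B * qpoch_inf (fps_const (w Col_c) * fps_X) (fps_X\<^sup>2) =
      qpoch_inf (- fps_const (w Col_a) * fps_X) (fps_X\<^sup>2) * qpoch_inf (- fps_const (w Col_d) * fps_X) (fps_X\<^sup>2)"
  shows "fps_X ^ n dvd scaled_gf w n - B"
proof -
  define a c d where acd: "a = fps_const (w Col_a)" "c = fps_const (w Col_c)" "d = fps_const (w Col_d)"
  define p :: "'r fps \<Rightarrow> nat \<Rightarrow> 'r fps" where "p = (\<lambda>x. qpoch (x * fps_X) (fps_X\<^sup>2))"
  define P :: "'r fps \<Rightarrow> 'r fps" where "P = (\<lambda>x. qpoch_inf (x * fps_X) (fps_X\<^sup>2))"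
  define b where "b = (\<lambda>j. p (- a) j * p (- d) j * unit_inv (p c j))"
  have p_inv: "p x j * unit_inv (p x j) = 1" for x j
    unfolding p_def by (intro mult_unit_inv qpoch_nth_0) simp
  have p_nonzero: "p x j \<noteq> 0" for x j
    using p_inv[of x j] by auto
  have P_inv: "P x * unit_inv (P x) = 1" for x
    unfolding P_def by (intro mult_unit_inv qpoch_inf_nth_0) simp_all
  have cong: "fps_X ^ (2 * j + 1) dvd P x - p x j" for x j
    unfolding p_def P_def by (rule qpoch_inf_cong) simp_all
  have b_mult: "b j * p c j = p (- a) j * p (- d) j" for j
    using p_inv[of c j] unfolding b_def by (simp add: mult_ac)
  have B': "B * P c = P (- a) * P (- d)"
    using B by (simp add: P_def acd)
  have "fps_X ^ (2 * j + 1) dvd b j - B" for j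
  proof -
    \<comment> \<open>The quotients \<open>b j\<close> and \<open>B\<close> are compared after
      clearing denominators, which are units.\<close>
    have "p (- a) j * p (- d) j * (P c - p c j) - (P (- a) * P (- d) - p (- a) j * p (- d) j) * p c j =
        (b j - B) * p c j * P c"
      unfolding b_mult[symmetric] B'[symmetric] by (simp add: algebra_simps)
    moreover have "fps_X ^ (2 * j + 1) dvd
        p (- a) j * p (- d) j * (P c - p c j) - (P (- a) * P (- d) - p (- a) j * p (- d) j) * p c j"
      by (intro dvd_diff dvd_mult dvd_mult2 dvd_mult_diff cong)
    ultimately have "fps_X ^ (2 * j + 1) dvd (b j - B) * p c j * P c"
      by simp
    then have "fps_X ^ (2 * j + 1) dvd (b j - B) * p c j * P c * (unit_inv (p c j) * unit_inv (P c))"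
      by (rule dvd_mult2)
    also have "\<dots> = (b j - B) * (p c j * unit_inv (p c j)) * (P c * unit_inv (P c))"
      by (simp only: mult_ac)
    finally show ?thesis by (simp add: p_inv P_inv)
  qed
  note even_cong = exp_mult_even_cong[of b B, OF this]
  define V where "V = exp_series * even_series b"
  have b_Suc: "(1 - c * fps_X * (fps_X\<^sup>2) ^ j) * b (Suc j) =
      (1 + a * fps_X * (fps_X\<^sup>2) ^ j) * (1 + d * fps_X * (fps_X\<^sup>2) ^ j) * b j" for j
  proof -
    have p_Suc: "p x (Suc j) = p x j * (1 - x * fps_X * (fps_X\<^sup>2) ^ j)" for x
      by (simp add: p_def qpoch_Suc)
    have "p c j * ((1 - c * fps_X * (fps_X\<^sup>2) ^ j) * b (Suc j)) = b (Suc j) * p c (Suc j)"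
      by (simp only: p_Suc mult_ac)
    also have "\<dots> = p c j * ((1 + a * fps_X * (fps_X\<^sup>2) ^ j) * (1 + d * fps_X * (fps_X\<^sup>2) ^ j) * b j)"
    proof -
      have "(p (- a) j * p (- d) j) * ((1 + a * fps_X * (fps_X\<^sup>2) ^ j) * (1 + d * fps_X * (fps_X\<^sup>2) ^ j)) =
          p (- a) (Suc j) * p (- d) (Suc j)"
        by (simp add: p_Suc mult_ac)
      then show ?thesis
        unfolding b_mult unfolding b_mult[of j, symmetric] by (simp only: mult_ac)
    qed
    finally show ?thesis by (rule mult_left_cancel[OF p_nonzero, THEN iffD1])
  qed
  have "scaled_gf w n = qpoch fps_X fps_X n * V $ n"
  proof (rule gf_recurrence_unique)
    show "gf_recurrence a c d (scaled_gf w)"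
      unfolding acd by (rule gf_recurrence_scaled_gf[of w, OF w])
    show "gf_recurrence a c d (\<lambda>n. qpoch fps_X fps_X n * V $ n)"
      unfolding V_def by (rule gf_recurrence_exp_mult_even[OF b_Suc])
    have b0: "b 0 = 1"
      using p_inv[of c 0] by (simp add: b_def p_def)
    then show "scaled_gf w 0 = qpoch fps_X fps_X 0 * V $ 0"
      by (simp add: scaled_gf_def V_def)
    \<comment> \<open>\<open>even_series b\<close> has no term in \<open>x\<close>, so only this
      coefficient enters the second initial value.\<close>
    have "(1 - fps_X) * exp_series $ 1 = (1 :: 'r fps)"
      using exp_series_Suc[of 0] by simp
    then show "scaled_gf w 1 = qpoch fps_X fps_X 1 * V $ 1"
      by (simp add: scaled_gf_def V_def b0 fps_mult_nth qpoch_def)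
  qed
  moreover have "B * qpoch fps_X fps_X n * (exp_series * even_series (\<lambda>_. 1)) $ n = B"
    by (simp add: mult.assoc exp_mult_even_1)
  ultimately have "scaled_gf w n - B = qpoch fps_X fps_X n *
      (V $ n - B * (exp_series * even_series (\<lambda>_. 1)) $ n)"
    by (simp add: algebra_simps)
  also have "fps_X ^ n dvd \<dots>"
    unfolding V_def by (intro dvd_mult even_cong)
  finally show ?thesis .
qed

text \<open>A partition of \<open>n \<le> k\<close> has no part above \<open>k\<close>.\<close>

lemma part_gf_below_cong:
  "fps_X ^ Suc k dvd part_gf w UNIV - part_gf w (below k)"
proof -
  have "fst (hd ps) \<le> sum_list (map fst ps)" if "ps \<noteq> []" for ps :: "(nat \<times> colour) list"
    using that by (cases ps) auto
  then have "{ps. ps \<in> UNIV \<and> coloured_partition ps \<and> sum_list (map fst ps) = n} =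
      {ps. ps \<in> below k \<and> coloured_partition ps \<and> sum_list (map fst ps) = n}" if "n \<le> k" for n
    using that unfolding below_def by force
  then show ?thesis
    unfolding fps_X_power_dvd_iff part_gf_def by (simp add: less_Suc_eq_le)
qed

text \<open>For every \<open>n\<close>, modulo \<open>q^(n+1)\<close>, \<open>part_gf w UNIV\<close>
  times \<open>(q; q)_\<infinity>\<close> agrees with \<open>scaled_gf w (Suc n)\<close>, hence with
  \<open>B\<close>.\<close>

lemma part_gf_product:
  fixes w :: "colour \<Rightarrow> 'r::idom"
  assumes w: "w Col_b = 1"
  shows "part_gf w UNIV * (qpoch_inf fps_X fps_X * qpoch_inf (fps_const (w Col_c) * fps_X) (fps_X\<^sup>2)) =
    qpoch_inf (- fps_const (w Col_a) * fps_X) (fps_X\<^sup>2) * qpoch_inf (- fps_const (w Col_d) * fps_X) (fps_X\<^sup>2)"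
proof -
  let ?C = "qpoch_inf (fps_const (w Col_c) * fps_X) (fps_X\<^sup>2)"
  let ?N = "qpoch_inf (- fps_const (w Col_a) * fps_X) (fps_X\<^sup>2) * qpoch_inf (- fps_const (w Col_d) * fps_X) (fps_X\<^sup>2)"
  define B where "B = ?N * unit_inv ?C"
  have C: "?C * unit_inv ?C = 1"
    by (intro mult_unit_inv qpoch_inf_nth_0) simp_all
  have "B * ?C = ?N * (?C * unit_inv ?C)"
    by (simp only: B_def mult_ac)
  then have B: "B * ?C = ?N"
    by (simp only: C mult_1_right)
  have "part_gf w UNIV * qpoch_inf fps_X fps_X - B = 0"
  proof (rule fps_eq_0_if_X_powers_dvd)
    fix n
    have "fps_X ^ Suc n dvd part_gf w UNIV * qpoch_inf fps_X fps_X - part_gf w (below n) * qpoch fps_X fps_X n"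
      using qpoch_inf_cong[of "fps_X :: 'r fps" 1 n] by (intro dvd_mult_diff part_gf_below_cong) simp
    moreover have "fps_X ^ Suc n dvd part_gf w (below n) * qpoch fps_X fps_X n - B"
      using scaled_gf_cong[OF w B, of "Suc n"] by (simp add: scaled_gf_def mult.commute del: power_Suc)
    ultimately have "fps_X ^ Suc n dvd
        (part_gf w UNIV * qpoch_inf fps_X fps_X - part_gf w (below n) * qpoch fps_X fps_X n) +
        (part_gf w (below n) * qpoch fps_X fps_X n - B)"
      by (rule dvd_add)
    then have "fps_X ^ Suc n dvd part_gf w UNIV * qpoch_inf fps_X fps_X - B"
      by (simp only: diff_add_cancel add_diff_eq)
    moreover have "fps_X ^ n dvd (fps_X :: 'r fps) ^ Suc n"
      by (intro le_imp_power_dvd) simp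
    ultimately show "fps_X ^ n dvd part_gf w UNIV * qpoch_inf fps_X fps_X - B"
      by (rule dvd_trans[rotated])
  qed
  then show ?thesis using B by (simp add: mult.assoc[symmetric])
qed

section \<open>Specialisation to the variables a, c, d\<close>

fun colour_weight :: "colour \<Rightarrow> rat fps fps fps" where
  "colour_weight Col_a = fps_X"
| "colour_weight Col_b = 1"
| "colour_weight Col_c = fps_const fps_X"
| "colour_weight Col_d = fps_const (fps_const fps_X)"

lemma prod_list_colour_weight_nth:
  "prod_list (map (colour_weight \<circ> snd) ps) $ k $ l $ m =
     (if count_list (map snd ps) Col_a = k \<and> count_list (map snd ps) Col_c = l \<and>
         count_list (map snd ps) Col_d = m then 1 else 0)"
proof -
  have "prod_list (map (colour_weight \<circ> snd) ps) =
      fps_X ^ count_list (map snd ps) Col_a * fps_const (fps_X ^ count_list (map snd ps) Col_c *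
      fps_const (fps_X ^ count_list (map snd ps) Col_d))"
  proof (induction ps)
    case (Cons p ps)
    then show ?case
      by (cases "snd p") (simp_all add: mult_ac flip: fps_const_mult)
  qed simp
  then show ?thesis
    by (auto simp: fps_X_power_mult_nth)
qed

text \<open>Each partition contributes one monomial recording its colour counts;
  \<open>Col_b\<close> has weight 1 because parts of that colour are not recorded.\<close>

lemma gen_series_A_eq: "gen_series A = part_gf colour_weight UNIV"
proof (intro fps_ext)
  fix n k l m
  let ?S = "{ps. coloured_partition ps \<and> sum_list (map fst ps) = n}"
  let ?Q = "\<lambda>ps. count_list (map snd ps) Col_a = k \<and> count_list (map snd ps) Col_c = l \<and>
         count_list (map snd ps) Col_d = m"
  have fin: "finite ?S" using finite_coloured_partitions[of UNIV n] by simp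
  have "part_gf colour_weight UNIV $ n $ k $ l $ m = (\<Sum>ps\<in>?S. if ?Q ps then 1 else 0)"
    by (simp add: part_gf_def fps_sum_nth prod_list_colour_weight_nth)
  also have "\<dots> = of_nat (card {ps\<in>?S. ?Q ps})"
    by (subst sum.inter_filter[OF fin, symmetric]) simp
  also have "{ps\<in>?S. ?Q ps} = partitions_of n k l m"
    by (auto simp: partitions_of_def)
  finally show "gen_series A $ n $ k $ l $ m = part_gf colour_weight UNIV $ n $ k $ l $ m"
    by (simp add: gen_series_def A_def)
qed

theorem theorem1p1:
  shows "gen_series A =
    qpoch_inf (- var_a * var_q) (var_q ^ 2) * qpoch_inf (- var_d * var_q) (var_q ^ 2) /
    (qpoch_inf var_q var_q * qpoch_inf (var_c * var_q) (var_q ^ 2))"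
proof (rule sym, rule fps_divide_eq_if_mult_eq)
  show "inverse (1 :: rat fps fps fps) = 1"
    by (simp add: fps_inverse_one')
  have "qpoch_inf var_q var_q $ 0 = 1"
    using qpoch_inf_nth_0[of "fps_X :: fps4" 1] by (simp add: var_q_def)
  moreover have "qpoch_inf (var_c * var_q) (var_q ^ 2) $ 0 = 1"
    unfolding var_q_def by (rule qpoch_inf_nth_0) simp_all
  ultimately show "(qpoch_inf var_q var_q * qpoch_inf (var_c * var_q) (var_q ^ 2)) $ 0 = 1"
    by simp
  show "gen_series A * (qpoch_inf var_q var_q * qpoch_inf (var_c * var_q) (var_q ^ 2)) =
      qpoch_inf (- var_a * var_q) (var_q ^ 2) * qpoch_inf (- var_d * var_q) (var_q ^ 2)"
    using part_gf_product[of colour_weight]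
    by (simp add: gen_series_A_eq var_q_def var_a_def var_c_def var_d_def)
qed

end
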